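(* Let $B$ be one of the boards $\{1,\ldots,n\}\times\{1,\ldots,n\}$ for some integer $n\ge 1$, $\mathbb{N}\times\mathbb{N}$, or $\mathbb{Z}\times\mathbb{Z}$. Then the Queen graph on $B$ has no odd independent set $S$ with $2\leq |S|<\infty$.
   Context: Here $\mathbb{N}=\{1,2,3,\ldots\}$. The Queen graph on a board $B\subseteq\mathbb{Z}\times\mathbb{Z}$ has vertex set $B$, and two distinct vertices $(a,b),(a',b')$ are adjacent iff $a=a'$, or $b=b'$, or $a-a'=b-b'$, or $a-a'=b'-b$. (The Queen graph of size $n$ is the one on $\{1,\ldots,n\}^2$; the infinite Queen graph is the one on the quarter plane $\mathbb{N}\times\mathbb{N}$ or on the whole plane $\mathbb{Z}\times\mathbb{Z}$.) For a graph $G=(V,E)$, $N(v)$ denotes the open neighborhood of $v$. A set $S\subseteq V$ is an odd independent set if it is independent (no two of its vertices are adjacent) and, for every vertex $v\in V\setminus S$, the set $N(v)\cap S$ is empty or of odd size. *)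

theory Defs
  imports Main
begin

text \<open>A simple graph is given by its vertex set and its set of edges, encoded as a symmetric
  and irreflexive relation.\<close>

type_synonym 'a sgraph = "'a set \<times> ('a \<times> 'a) set"

abbreviation vertices :: "'a sgraph \<Rightarrow> 'a set" where
  "vertices G \<equiv> fst G"

abbreviation edges :: "'a sgraph \<Rightarrow> ('a \<times> 'a) set" where
  "edges G \<equiv> snd G"

definition simple_graph :: "'a sgraph \<Rightarrow> bool" where
  "simple_graph G \<longleftrightarrow> edges G \<subseteq> vertices G \<times> vertices G \<and> sym (edges G) \<and> irrefl (edges G)"

definition open_neighborhood :: "'a sgraph \<Rightarrow> 'a \<Rightarrow> 'a set" where
  "open_neighborhood G v = {u \<in> vertices G. (v, u) \<in> edges G}"

definition independent_set :: "'a sgraph \<Rightarrow> 'a set \<Rightarrow> bool" where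
  "independent_set G S \<longleftrightarrow>
     S \<subseteq> vertices G \<and> (\<forall>u\<in>S. \<forall>v\<in>S. (u, v) \<notin> edges G)"

text \<open>Since the cardinality of an infinite set is \<open>0\<close>, which is even, an odd cardinality
  implies finiteness.\<close>

definition odd_independent_set :: "'a sgraph \<Rightarrow> 'a set \<Rightarrow> bool" where
  "odd_independent_set G S \<longleftrightarrow>
     independent_set G S \<and>
     (\<forall>v \<in> vertices G - S.
        open_neighborhood G v \<inter> S = {} \<or> odd (card (open_neighborhood G v \<inter> S)))"

definition queen_adjacent :: "int \<times> int \<Rightarrow> int \<times> int \<Rightarrow> bool" where
  "queen_adjacent p q \<longleftrightarrow>
     p \<noteq> q \<and>
     (fst p = fst q \<or> snd p = snd q \<or>
      fst p - fst q = snd p - snd q \<or> fst p - fst q = snd q - snd p)"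

definition queen_graph :: "(int \<times> int) set \<Rightarrow> (int \<times> int) sgraph" where
  "queen_graph B = (B, {(p, q) \<in> B \<times> B. queen_adjacent p q})"

lemma simple_graph_queen_graph: "simple_graph (queen_graph B)"
  unfolding simple_graph_def queen_graph_def queen_adjacent_def
  by (auto simp: sym_def irrefl_def)

definition square_board :: "nat \<Rightarrow> (int \<times> int) set" where
  "square_board n = {1..int n} \<times> {1..int n}"

text \<open>Here the natural numbers start at \<open>1\<close>.\<close>

definition quarter_plane_board :: "(int \<times> int) set" where
  "quarter_plane_board = {1..} \<times> {1..}"

definition plane_board :: "(int \<times> int) set" where
  "plane_board = UNIV \<times> UNIV"

end

theory Submission
  imports Defs
begin

text \<open>Let \<open>S\<close> consist of \<open>k\<close> queens. A cell in which the column of one queen meets the row of another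
  lies on every board containing both, hence it is attacked along a further line, a diagonal or an
  antidiagonal. Let \<open>a\<close> and \<open>b\<close> be the extreme columns of \<open>S\<close>. Each of the \<open>2k\<close> cells in which they
  meet the rows of \<open>S\<close> is covered by one of the \<open>2k\<close> diagonals and antidiagonals of \<open>S\<close>, and the two
  queens among them are covered twice, which makes at least \<open>2k + 2\<close> incidences. A diagonal meets two
  of these cells only if the bounding box has height at least \<open>b - a\<close>. By symmetry the box is therefore
  a square, where only the two main diagonals can meet two of these cells. So every estimate is
  tight: a cell without a queen on the boundary of the box in a row and a column of \<open>S\<close> lies on
  exactly one diagonal or antidiagonal, and each of these lines ends in a row and in a column of \<open>S\<close>.
  Following the diagonals from a boundary queen that is not in a corner around the square gives
  a contradiction; the bottom and the top queen cannot both be in corners.\<close>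

text \<open>Inclusion-exclusion for sorting the lines of one family by which of two columns they
  meet in an occupied row.\<close>

lemma card_filter_add:
  assumes "finite M"
  shows "card {t \<in> M. P t} + card {t \<in> M. Q t} + card {t \<in> M. \<not> P t \<and> \<not> Q t}
    = card M + card {t \<in> M. P t \<and> Q t}"
proof -
  let ?P = "{t \<in> M. P t}" and ?Q = "{t \<in> M. Q t}" and ?N = "{t \<in> M. \<not> P t \<and> \<not> Q t}"
  have "card ?P + card ?Q = card (?P \<union> ?Q) + card (?P \<inter> ?Q)"
    using assms by (intro card_Un_Int) simp_all
  moreover have "card ((?P \<union> ?Q) \<union> ?N) = card (?P \<union> ?Q) + card ?N"
    using assms by (intro card_Un_disjoint) auto
  moreover have "(?P \<union> ?Q) \<union> ?N = M" "?P \<inter> ?Q = {t \<in> M. P t \<and> Q t}"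
    by auto
  ultimately show ?thesis by simp
qed

text \<open>The board is forgotten here. The assumptions are preserved by swapping the coordinates
  and by reflection, so symmetric cases follow by applying the locale to an image of
  \<open>S\<close>. For \<open>p = q\<close> the condition \<open>cover\<close> holds trivially with
  \<open>s = p\<close>.\<close>

locale covering_queens =
  fixes S :: "(int \<times> int) set"
  assumes finite_S: "finite S"
    and independent: "\<And>p q. p \<in> S \<Longrightarrow> q \<in> S \<Longrightarrow>
      fst p = fst q \<or> snd p = snd q \<or>
      fst p - snd p = fst q - snd q \<or> fst p + snd p = fst q + snd q \<Longrightarrow> p = q"
    and cover: "\<And>p q. p \<in> S \<Longrightarrow> q \<in> S \<Longrightarrow>
      \<exists>s\<in>S. fst s - snd s = fst p - snd q \<or> fst s + snd s = fst p + snd q"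
begin

definition cols where "cols = fst ` S"
definition rows where "rows = snd ` S"
definition diags where "diags = (\<lambda>p. fst p - snd p) ` S"
definition antis where "antis = (\<lambda>p. fst p + snd p) ` S"

lemmas line_defs = cols_def rows_def diags_def antis_def

lemma inj_lines:
  "inj_on fst S" "inj_on snd S" "inj_on (\<lambda>p. fst p - snd p) S" "inj_on (\<lambda>p. fst p + snd p) S"
  by (rule inj_onI, erule (1) independent, blast)+

lemma finite_lines: "finite cols" "finite rows" "finite diags" "finite antis"
  using finite_S by (auto simp: line_defs)

lemma card_lines: "card diags = card rows" "card antis = card rows"
  by (simp_all add: line_defs card_image inj_lines)

lemma cell_covered: "x \<in> cols \<Longrightarrow> y \<in> rows \<Longrightarrow> x - y \<in> diags \<or> x + y \<in> antis"
proof -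
  assume "x \<in> cols" "y \<in> rows"
  then obtain p q where pq: "p \<in> S" "q \<in> S" "x = fst p" "y = snd q"
    by (auto simp: cols_def rows_def)
  obtain s where "s \<in> S" "fst s - snd s = x - y \<or> fst s + snd s = x + y"
    using cover[OF pq(1,2)] pq(3,4) by blast
  then show ?thesis
    unfolding diags_def antis_def by (metis (no_types, lifting) image_eqI)
qed

lemma queen_lines:
  assumes "(x, y) \<in> S"
  shows "x \<in> cols" "y \<in> rows" "x - y \<in> diags" "x + y \<in> antis"
  using imageI[OF assms, of fst] imageI[OF assms, of snd]
    imageI[OF assms, of "\<lambda>p. fst p - snd p"] imageI[OF assms, of "\<lambda>p. fst p + snd p"]
  by (simp_all add: line_defs)

lemma queen_eqI:
  assumes "(x, y) \<in> S" "(x', y') \<in> S" "x = x' \<or> y = y' \<or> x - y = x' - y' \<or> x + y = x' + y'"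
  shows "x = x' \<and> y = y'"
  using independent[OF assms(1,2)] assms(3) by simp

section \<open>Counting incidences of lines with two columns\<close>

definition crossings :: "int \<Rightarrow> int set" where
  "crossings x = {y \<in> rows. x - y \<in> diags \<and> x + y \<in> antis}"

text \<open>A line \<open>d\<close> of \<open>diags\<close> meets column \<open>x\<close> in row
  \<open>x - d\<close>, and a line \<open>s\<close> of \<open>antis\<close> in row
  \<open>s - x\<close>. Hence the left side counts the cells of the column in occupied rows by the
  lines through them; all are covered, and \<open>crossings x\<close> collects those covered
  twice.\<close>

lemma card_crossings:
  assumes "x \<in> cols"
  shows "card {d \<in> diags. x - d \<in> rows} + card {s \<in> antis. s - x \<in> rows} = card rows + card (crossings x)"
proof -
  let ?D = "{y \<in> rows. x - y \<in> diags}" and ?A = "{y \<in> rows. x + y \<in> antis}"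
  have "card ?D = card {d \<in> diags. x - d \<in> rows}"
    by (rule bij_betw_same_card, rule bij_betw_byWitness[where f = "\<lambda>y. x - y" and f' = "\<lambda>d. x - d"]) auto
  moreover have "card ?A = card {s \<in> antis. s - x \<in> rows}"
    by (rule bij_betw_same_card, rule bij_betw_byWitness[where f = "\<lambda>y. x + y" and f' = "\<lambda>s. s - x"]) auto
  moreover have "card ?D + card ?A = card (?D \<union> ?A) + card (?D \<inter> ?A)"
    by (rule card_Un_Int) (auto simp: finite_lines)
  moreover have "?D \<union> ?A = rows"
    using cell_covered[OF assms] by auto
  moreover have "?D \<inter> ?A = crossings x"
    by (auto simp: crossings_def)
  ultimately show ?thesis
    by simp
qed

text \<open>Add \<open>card_crossings\<close> for both columns. Each family has
  \<open>card rows\<close> lines, so these terms cancel and only the lines that meet both columns or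
  neither in occupied rows remain.\<close>

lemma two_columns_balance:
  assumes "a \<in> cols" "b \<in> cols"
  shows "card (crossings a) + card (crossings b)
      + card {d \<in> diags. a - d \<notin> rows \<and> b - d \<notin> rows}
      + card {s \<in> antis. s - a \<notin> rows \<and> s - b \<notin> rows}
    = card {d \<in> diags. a - d \<in> rows \<and> b - d \<in> rows}
      + card {s \<in> antis. s - a \<in> rows \<and> s - b \<in> rows}"
  using card_crossings[OF assms(1)] card_crossings[OF assms(2)] card_lines
    card_filter_add[OF finite_lines(3), of "\<lambda>d. a - d \<in> rows" "\<lambda>d. b - d \<in> rows"]
    card_filter_add[OF finite_lines(4), of "\<lambda>s. s - a \<in> rows" "\<lambda>s. s - b \<in> rows"]
  by linarith

lemma finite_crossings: "finite (crossings x)"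
  by (simp add: crossings_def finite_lines)

lemma queen_crossing: "(x, y) \<in> S \<Longrightarrow> y \<in> crossings x"
  using queen_lines by (simp add: crossings_def)

lemma obtain_queen_in_col:
  assumes "x \<in> cols" obtains y where "(x, y) \<in> S"
  using assms by (auto simp: cols_def)

lemma crossings_pos: "x \<in> cols \<Longrightarrow> card (crossings x) \<ge> 1"
proof -
  assume "x \<in> cols"
  then obtain y where "(x, y) \<in> S" by (rule obtain_queen_in_col)
  then have "crossings x \<noteq> {}" using queen_crossing by blast
  then show ?thesis by (simp add: Suc_le_eq card_gt_0_iff finite_crossings)
qed

text \<open>A line meets the two columns in rows at distance \<open>b - a\<close>. If this exceeds
  \<open>h\<close>, the right side of \<open>two_columns_balance\<close> vanishes, while the queen
  in column \<open>a\<close> makes the left side positive.\<close>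

lemma width_le_height:
  assumes "a \<in> cols" "b \<in> cols" "rows \<subseteq> {c..c + h}"
  shows "b - a \<le> h"
proof (rule ccontr)
  assume wide: "\<not> b - a \<le> h"
  have "\<not> (a - d \<in> rows \<and> b - d \<in> rows)" "\<not> (s - a \<in> rows \<and> s - b \<in> rows)" for d s
    using subsetD[OF assms(3), of "a - d"] subsetD[OF assms(3), of "b - d"]
      subsetD[OF assms(3), of "s - a"] subsetD[OF assms(3), of "s - b"] wide by auto
  then have none: "{d \<in> diags. a - d \<in> rows \<and> b - d \<in> rows} = {}"
    "{s \<in> antis. s - a \<in> rows \<and> s - b \<in> rows} = {}"
    by blast+
  show False
    using two_columns_balance[OF assms(1,2), unfolded none] crossings_pos[OF assms(1)] by simp
qed

text \<open>In \<open>two_columns_balance\<close> the right side is now at most 2, and the queens of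
  the two columns already contribute 2 to the left. So the only doubly covered cells there are these
  queens, and no line misses the occupied rows in both columns.\<close>

lemma vertical_sides_tight:
  assumes "a \<in> cols" "a + n \<in> cols" "rows \<subseteq> {c..c + n}" "n > 0"
  shows "\<And>x y. x = a \<or> x = a + n \<Longrightarrow> y \<in> rows \<Longrightarrow> x - y \<in> diags \<Longrightarrow> x + y \<in> antis \<Longrightarrow> (x, y) \<in> S"
    and "\<And>d. d \<in> diags \<Longrightarrow> a - d \<in> rows \<or> a + n - d \<in> rows"
    and "\<And>s. s \<in> antis \<Longrightarrow> s - a \<in> rows \<or> s - (a + n) \<in> rows"
proof -
  let ?D = "{d \<in> diags. a - d \<notin> rows \<and> a + n - d \<notin> rows}"
  let ?A = "{s \<in> antis. s - a \<notin> rows \<and> s - (a + n) \<notin> rows}"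
  \<comment> \<open>Only the two main diagonals of the square meet both vertical sides.\<close>
  have "{d \<in> diags. a - d \<in> rows \<and> a + n - d \<in> rows} \<subseteq> {a - c}"
    "{s \<in> antis. s - a \<in> rows \<and> s - (a + n) \<in> rows} \<subseteq> {a + n + c}"
    by (auto dest!: subsetD[OF assms(3)])
  then have "card {d \<in> diags. a - d \<in> rows \<and> a + n - d \<in> rows} \<le> 1"
    "card {s \<in> antis. s - a \<in> rows \<and> s - (a + n) \<in> rows} \<le> 1"
    by (auto dest: card_mono[rotated])
  then have tight: "card (crossings a) = 1" "card (crossings (a + n)) = 1" "card ?D = 0" "card ?A = 0"
    using two_columns_balance[OF assms(1,2)] crossings_pos[OF assms(1)] crossings_pos[OF assms(2)]
    by linarith+
  have "finite ?D" "finite ?A"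
    by (simp_all add: finite_lines)
  then have "?D = {}" "?A = {}"
    using tight(3,4) card_0_eq by blast+
  then show "\<And>d. d \<in> diags \<Longrightarrow> a - d \<in> rows \<or> a + n - d \<in> rows"
    and "\<And>s. s \<in> antis \<Longrightarrow> s - a \<in> rows \<or> s - (a + n) \<in> rows"
    by blast+
  fix x y
  assume x: "x = a \<or> x = a + n" and y: "y \<in> rows" "x - y \<in> diags" "x + y \<in> antis"
  then have "x \<in> cols" using assms by auto
  then obtain y' where y': "(x, y') \<in> S" by (rule obtain_queen_in_col)
  have "y \<in> crossings x" "y' \<in> crossings x" "card (crossings x) = 1"
    using x y y' tight queen_crossing by (auto simp: crossings_def)
  then have "y = y'"
    by (metis card_1_singletonE singletonD)
  then show "(x, y) \<in> S" using y' by simp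
qed

section \<open>Symmetries and the sides of the bounding square\<close>

lemma swap_queens: "covering_queens (prod.swap ` S)"
proof
  show "p = q" if "p \<in> prod.swap ` S" "q \<in> prod.swap ` S"
    "fst p = fst q \<or> snd p = snd q \<or>
      fst p - snd p = fst q - snd q \<or> fst p + snd p = fst q + snd q" for p q
  proof -
    have "(snd p, fst p) \<in> S" "(snd q, fst q) \<in> S" using that(1,2) by auto
    then have "snd p = snd q \<and> fst p = fst q"
      by (rule queen_eqI) (use that(3) in arith)
    then show ?thesis by (simp add: prod_eq_iff)
  qed
  fix p q assume "p \<in> prod.swap ` S" "q \<in> prod.swap ` S"
  then have "prod.swap p \<in> S" "prod.swap q \<in> S" by auto
  then obtain s where "s \<in> S" "fst s - snd s = snd q - fst p \<or> fst s + snd s = snd q + fst p"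
    using cover[of "prod.swap q" "prod.swap p"] by auto
  then show "\<exists>s\<in>prod.swap ` S. fst s - snd s = fst p - snd q \<or> fst s + snd s = fst p + snd q"
    by (intro bexI[of _ "prod.swap s"]) auto
qed (simp add: finite_S)

lemma reflect_queens: "covering_queens ((\<lambda>p. (fst p, - snd p)) ` S)"
proof
  show "p = q" if "p \<in> (\<lambda>p. (fst p, - snd p)) ` S" "q \<in> (\<lambda>p. (fst p, - snd p)) ` S"
    "fst p = fst q \<or> snd p = snd q \<or>
      fst p - snd p = fst q - snd q \<or> fst p + snd p = fst q + snd q" for p q
  proof -
    have "(fst p, - snd p) \<in> S" "(fst q, - snd q) \<in> S" using that(1,2) by auto
    then have "fst p = fst q \<and> - snd p = - snd q"
      by (rule queen_eqI) (use that(3) in arith)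
    then show ?thesis by (simp add: prod_eq_iff)
  qed
  fix p q assume "p \<in> (\<lambda>p. (fst p, - snd p)) ` S" "q \<in> (\<lambda>p. (fst p, - snd p)) ` S"
  then have "(fst p, - snd p) \<in> S" "(fst q, - snd q) \<in> S" by auto
  then obtain s where "s \<in> S" "fst s - snd s = fst p + snd q \<or> fst s + snd s = fst p - snd q"
    using cover[of "(fst p, - snd p)" "(fst q, - snd q)"] by auto
  then show "\<exists>s\<in>(\<lambda>p. (fst p, - snd p)) ` S. fst s - snd s = fst p - snd q \<or> fst s + snd s = fst p + snd q"
    by (intro bexI[of _ "(fst s, - snd s)"]) auto
qed (simp add: finite_S)

lemma swap_lines:
  "covering_queens.cols (prod.swap ` S) = rows"
  "covering_queens.rows (prod.swap ` S) = cols"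
  "covering_queens.diags (prod.swap ` S) = uminus ` diags"
  "covering_queens.antis (prod.swap ` S) = antis"
  by (simp_all add: covering_queens.line_defs[OF swap_queens] line_defs image_image add.commute)

lemma horizontal_sides_tight:
  assumes "c \<in> rows" "c + n \<in> rows" "cols \<subseteq> {a..a + n}" "n > 0"
  shows "\<And>x y. y = c \<or> y = c + n \<Longrightarrow> x \<in> cols \<Longrightarrow> x - y \<in> diags \<Longrightarrow> x + y \<in> antis \<Longrightarrow> (x, y) \<in> S"
    and "\<And>d. d \<in> diags \<Longrightarrow> c + d \<in> cols \<or> c + n + d \<in> cols"
    and "\<And>s. s \<in> antis \<Longrightarrow> s - c \<in> cols \<or> s - (c + n) \<in> cols"
proof -
  note tight = covering_queens.vertical_sides_tight[OF swap_queens, unfolded swap_lines, OF assms]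
  show "(x, y) \<in> S" if "y = c \<or> y = c + n" "x \<in> cols" "x - y \<in> diags" "x + y \<in> antis" for x y
  proof -
    have "y - x \<in> uminus ` diags"
      using that(3) by (metis image_eqI minus_diff_eq)
    then have "(y, x) \<in> prod.swap ` S"
      using tight(1)[of y x] that by (simp add: add.commute)
    then show ?thesis by auto
  qed
  show "c + d \<in> cols \<or> c + n + d \<in> cols" if "d \<in> diags" for d
    using tight(2)[of "- d"] that by simp
  show "s - c \<in> cols \<or> s - (c + n) \<in> cols" if "s \<in> antis" for s
    using tight(3) that by simp
qed

lemma bottom_queen_at_corner:
  assumes "a \<in> cols" "a + n \<in> cols" "cols \<subseteq> {a..a + n}"
    and "c \<in> rows" "c + n \<in> rows" "rows \<subseteq> {c..c + n}"
    and "n > 0" "(a + p, c) \<in> S"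
  shows "p = 0 \<or> p = n"
proof (rule ccontr)
  assume "\<not> (p = 0 \<or> p = n)"
  moreover have "a + p \<in> cols" using queen_lines assms by blast
  ultimately have p: "0 < p" "p < n" using assms(3) by auto
  note vert = vertical_sides_tight[OF assms(1,2,6,7)]
  note hor = horizontal_sides_tight[OF assms(4,5,3,7)]
  have bounds: "x \<in> cols \<Longrightarrow> a \<le> x \<and> x \<le> a + n" "y \<in> rows \<Longrightarrow> c \<le> y \<and> y \<le> c + n" for x y
    using assms by auto
  note queen = queen_lines[OF assms(8)]
  \<comment> \<open>The two lines through the bottom queen end on the vertical sides at
    \<open>(a, c + p)\<close> and \<open>(a + n, c + n - p)\<close>; their other candidate ends lie
    below the square.\<close>
  have "c + p \<in> rows" using vert(3)[OF queen(4)] bounds(2)[of "c + p - n"] p by (auto simp: algebra_simps)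
  have "c + n - p \<in> rows" using vert(2)[OF queen(3)] bounds(2)[of "c - p"] p by (auto simp: algebra_simps)
  have no_queen: "(a, c + p) \<notin> S" "(a + n, c + n - p) \<notin> S" "(a + p, c + n) \<notin> S"
    using queen_eqI[OF assms(8)] p by fastforce+
  \<comment> \<open>Both end cells are already covered and hold no queen, so tightness forbids the
    second line through each.\<close>
  have diag_absent: "a - (c + p) \<notin> diags"
    using vert(1)[of a "c + p"] no_queen \<open>c + p \<in> rows\<close> queen by (auto simp: algebra_simps)
  have anti_absent: "a + n + (c + n - p) \<notin> antis"
    using vert(1)[of "a + n" "c + n - p"] no_queen \<open>c + n - p \<in> rows\<close> queen by (auto simp: algebra_simps)
  \<comment> \<open>The two forbidden lines meet at \<open>(a + n - p, c + n)\<close>, which would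
    be uncovered if its column were occupied.\<close>
  have "a + n - p \<notin> cols"
    using cell_covered[of "a + n - p" "c + n"] assms diag_absent anti_absent by (auto simp: algebra_simps)
  \<comment> \<open>The cell \<open>(a, c + n - p)\<close> must be covered. Its antidiagonal would
    meet the horizontal sides only in the empty column \<open>a + n - p\<close> or at
    \<open>a - p\<close>, left of the square. The next step is the mirror image, with the cell
    \<open>(a + n, c + p)\<close>.\<close>
  have "(a + p) - (c + n) \<in> diags"
  proof (rule ccontr)
    assume "(a + p) - (c + n) \<notin> diags"
    then have "a + (c + n - p) \<in> antis"
      using cell_covered[of a "c + n - p"] \<open>c + n - p \<in> rows\<close> assms by (auto simp: algebra_simps)
    then show False
      using hor(3) \<open>a + n - p \<notin> cols\<close> bounds(1)[of "a - p"] p by (fastforce simp: algebra_simps)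
  qed
  moreover have "(a + p) + (c + n) \<in> antis"
  proof (rule ccontr)
    assume "(a + p) + (c + n) \<notin> antis"
    then have "a + n - (c + p) \<in> diags"
      using cell_covered[of "a + n" "c + p"] \<open>c + p \<in> rows\<close> assms by (auto simp: algebra_simps)
    then show False
      using hor(2) \<open>a + n - p \<notin> cols\<close> bounds(1)[of "a + n + n - p"] p by (fastforce simp: algebra_simps)
  qed
  \<comment> \<open>The cell \<open>(a + p, c + n)\<close> is now doubly covered, so it would hold a
    second queen in column \<open>a + p\<close>.\<close>
  ultimately show False
    using hor(1)[of "c + n" "a + p"] no_queen queen by blast
qed

lemma reflect_lines:
  "covering_queens.cols ((\<lambda>p. (fst p, - snd p)) ` S) = cols"
  "covering_queens.rows ((\<lambda>p. (fst p, - snd p)) ` S) = uminus ` rows"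
  by (simp_all add: covering_queens.line_defs[OF reflect_queens] line_defs image_image)

lemma card_le_1: "card S \<le> 1"
proof (rule ccontr)
  assume "\<not> card S \<le> 1"
  then have "card cols > 1" "card rows > 1"
    by (simp_all add: line_defs card_image inj_lines)
  then have ne: "cols \<noteq> {}" "rows \<noteq> {}" by auto
  define a b c d where "a = Min cols" "b = Max cols" "c = Min rows" "d = Max rows"
  note abcd = this
  have mem: "a \<in> cols" "b \<in> cols" "c \<in> rows" "d \<in> rows"
    and sub: "cols \<subseteq> {a..b}" "rows \<subseteq> {c..d}"
    using ne finite_lines by (auto simp: abcd)
  have "b - a \<le> d - c"
    using width_le_height[OF mem(1,2), of c "d - c"] sub by simp
  moreover have "d - c \<le> b - a"
    using covering_queens.width_le_height[OF swap_queens, unfolded swap_lines, OF mem(3,4), of a "b - a"] sub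
    by simp
  moreover define n where "n = b - a"
  ultimately have n: "b = a + n" "d = c + n" by auto
  have "a \<noteq> b"
    using card_mono[OF _ sub(1)] \<open>card cols > 1\<close> by auto
  then have "n > 0" using n sub mem by auto
  note sq = mem(1) mem(2)[unfolded n] sub(1)[unfolded n] mem(3) mem(4)[unfolded n] sub(2)[unfolded n]
  obtain p where p: "(a + p, c) \<in> S"
    using mem(3) by (auto simp: rows_def) (metis add.commute diff_add_cancel)
  obtain q where q: "(a + q, c + n) \<in> S"
    using sq(5) by (auto simp: rows_def) (metis add.commute diff_add_cancel)
  have "p = 0 \<or> p = n"
    using bottom_queen_at_corner[OF sq \<open>n > 0\<close> p] .
  moreover have "q = 0 \<or> q = n"
  \<comment> \<open>Reflection turns the top row \<open>c + n\<close> into the bottom row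
    \<open>- (c + n)\<close>.\<close>
  proof (rule covering_queens.bottom_queen_at_corner[OF reflect_queens, unfolded reflect_lines])
    show "a \<in> cols" "a + n \<in> cols" "cols \<subseteq> {a..a + n}" "n > 0" by fact+
    show "- (c + n) \<in> uminus ` rows" "- (c + n) + n \<in> uminus ` rows"
      using imageI[OF sq(5), of uminus] imageI[OF sq(4), of uminus] by simp_all
    show "uminus ` rows \<subseteq> {- (c + n)..- (c + n) + n}" using sq(6) by auto
    show "(a + q, - (c + n)) \<in> (\<lambda>p. (fst p, - snd p)) ` S" using q by force
  qed
  \<comment> \<open>Any corner of the bottom side and any corner of the top side share a column or a
    main diagonal.\<close>
  ultimately show False
    using queen_eqI[OF p q] \<open>n > 0\<close> by auto
qed

end

section \<open>From odd independent sets to covering queens\<close>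

lemma queen_neighbor_iff:
  assumes "S \<subseteq> B"
  shows "open_neighborhood (queen_graph B) v \<inter> S = {s \<in> S. v \<in> B \<and> queen_adjacent v s}"
  using assms by (auto simp: open_neighborhood_def queen_graph_def)

text \<open>The cell in the column of \<open>p\<close> and the row of \<open>q\<close> sees both
  queens. Without a queen on its diagonals, independence leaves it no others, so it would have
  exactly two neighbours in \<open>S\<close>, a nonzero even number.\<close>

lemma odd_independent_covering:
  assumes odd: "odd_independent_set (queen_graph B) S" and fin: "finite S"
    and board: "\<And>p q. p \<in> B \<Longrightarrow> q \<in> B \<Longrightarrow> (fst p, snd q) \<in> B"
  shows "covering_queens S"
proof
  have sub: "S \<subseteq> B"
    using odd by (simp add: odd_independent_set_def independent_set_def queen_graph_def)
  have indep: "\<not> queen_adjacent p q" if "p \<in> S" "q \<in> S" for p q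
    using odd that subsetD[OF sub that(1)] subsetD[OF sub that(2)]
    by (simp add: odd_independent_set_def independent_set_def queen_graph_def)
  have parity: "open_neighborhood (queen_graph B) v \<inter> S = {} \<or>
      odd (card (open_neighborhood (queen_graph B) v \<inter> S))" if "v \<in> B" "v \<notin> S" for v
    using odd that by (simp add: odd_independent_set_def queen_graph_def)
  show "p = q" if "p \<in> S" "q \<in> S"
    "fst p = fst q \<or> snd p = snd q \<or>
      fst p - snd p = fst q - snd q \<or> fst p + snd p = fst q + snd q" for p q
  proof -
    have "fst p - snd p = fst q - snd q \<longleftrightarrow> fst p - fst q = snd p - snd q"
      "fst p + snd p = fst q + snd q \<longleftrightarrow> fst p - fst q = snd q - snd p"
      by linarith+
    then show ?thesis
      using indep[OF that(1,2)] that(3) unfolding queen_adjacent_def by blast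
  qed
  fix p q assume pq: "p \<in> S" "q \<in> S"
  show "\<exists>s\<in>S. fst s - snd s = fst p - snd q \<or> fst s + snd s = fst p + snd q"
  proof (cases "p = q")
    case True
    then show ?thesis using pq by (intro bexI[of _ p]) simp_all
  next
    case False
    let ?v = "(fst p, snd q)"
    have diff: "fst p \<noteq> fst q" "snd p \<noteq> snd q"
      using indep[OF pq] False by (auto simp: queen_adjacent_def)
    have "?v \<in> B"
      using board[OF subsetD[OF sub pq(1)] subsetD[OF sub pq(2)]] .
    have "?v \<notin> S"
      using indep[OF pq(1), of ?v] diff by (auto simp: queen_adjacent_def prod_eq_iff)
    show ?thesis
    proof (rule ccontr)
      assume no: "\<not> ?thesis"
      have "queen_adjacent ?v s \<longleftrightarrow> s = p \<or> s = q" if "s \<in> S" for s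
      proof
        assume "queen_adjacent ?v s"
        moreover have "fst s - snd s \<noteq> fst p - snd q" "fst s + snd s \<noteq> fst p + snd q"
          using no that by blast+
        ultimately have "fst s = fst p \<or> snd s = snd q"
          unfolding queen_adjacent_def fst_conv snd_conv by linarith
        then show "s = p \<or> s = q"
          using indep[OF that pq(1)] indep[OF that pq(2)] by (auto simp only: queen_adjacent_def)
      next
        have "?v \<noteq> p" "?v \<noteq> q"
          using diff by (metis snd_conv, metis fst_conv)
        then have "queen_adjacent ?v p" "queen_adjacent ?v q"
          by (simp_all add: queen_adjacent_def)
        then show "s = p \<or> s = q \<Longrightarrow> queen_adjacent ?v s"
          by blast
      qed
      then have "open_neighborhood (queen_graph B) ?v \<inter> S = {p, q}"
        unfolding queen_neighbor_iff[OF sub] using \<open>?v \<in> B\<close> pq by blast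
      moreover have "card {p, q} = 2" using False by simp
      ultimately show False
        using parity[OF \<open>?v \<in> B\<close> \<open>?v \<notin> S\<close>] by simp
    qed
  qed
qed fact

theorem theorem6:
  fixes B :: "(int \<times> int) set"
  assumes "(\<exists>n\<ge>1. B = square_board n) \<or> B = quarter_plane_board \<or> B = plane_board"
  shows "\<not> (\<exists>S. odd_independent_set (queen_graph B) S \<and> finite S \<and> 2 \<le> card S)"
proof
  assume "\<exists>S. odd_independent_set (queen_graph B) S \<and> finite S \<and> 2 \<le> card S"
  then obtain S where S: "odd_independent_set (queen_graph B) S" "finite S" "2 \<le> card S" by blast
  \<comment> \<open>All three boards are products of two sets of integers.\<close>
  have "(fst p, snd q) \<in> B" if "p \<in> B" "q \<in> B" for p q
    using assms that by (auto simp: square_board_def quarter_plane_board_def plane_board_def)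
  then show False
    using covering_queens.card_le_1[OF odd_independent_covering[OF S(1,2)]] S(3) by simp
qed

end
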